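(* Let $1<p<\infty$ and let $\{\gamma_n\}_{n\ge1}$, $\{q_n\}_{n\ge1}$ be sequences of real numbers with $\gamma_n>0$ and $q_n>0$ for every $n\in\mathbb{N}$. Then: (i) for every $x=\{a_n\}_{n\ge1}\in\Gamma_p$ one has $$x=\sum_{i=1}^{\infty}\Big(\gamma_i^{1/p}\sum_{k=1}^{i}q_ka_k\Big)u_i,$$ where the series converges in the norm of $\Gamma_p$; (ii) $\Gamma_p$ is separable.
   Context: Let $s$ be the space of all real or complex sequences. Define $$\Gamma_p=\Big\{x=\{a_n\}\in s:\ \sum_{n=1}^{\infty}\gamma_n\Big|\sum_{k=1}^{n}q_ka_k\Big|^p<\infty\Big\},\qquad \|x\|_{\Gamma_p}=\Big(\sum_{n=1}^{\infty}\gamma_n\Big|\sum_{k=1}^{n}q_ka_k\Big|^p\Big)^{1/p},$$ a normed space. For $n\in\mathbb{N}$, $u_n\in\Gamma_p$ is the sequence whose $n$-th entry is $\gamma_n^{-1/p}/q_n$, whose $(n+1)$-st entry is $-\gamma_n^{-1/p}/q_{n+1}$, and whose other entries are $0$. *)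

theory Defs
  imports "HOL-Analysis.Analysis"
begin

text \<open>
  Sequences are functions on \<^typ>\<open>nat\<close> and are enumerated from \<open>0\<close>: the entry written $a_{n+1}$
  in one-based notation is \<open>x n\<close>, and likewise for \<open>\<gamma>\<close>, \<open>q\<close> and the family \<open>u\<close>.
  The scalars range over a type of class \<^class>\<open>real_normed_field\<close>, to be instantiated with
  \<^typ>\<open>real\<close> and \<^typ>\<open>complex\<close>.
\<close>

definition weighted_sum :: "(nat \<Rightarrow> real) \<Rightarrow> (nat \<Rightarrow> 'a::real_normed_field) \<Rightarrow> nat \<Rightarrow> 'a" where
  "weighted_sum q x n = (\<Sum>k\<le>n. of_real (q k) * x k)"

definition Gamma_space ::
  "real \<Rightarrow> (nat \<Rightarrow> real) \<Rightarrow> (nat \<Rightarrow> real) \<Rightarrow> (nat \<Rightarrow> 'a::real_normed_field) set" where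
  "Gamma_space p \<gamma> q = {x. summable (\<lambda>n. \<gamma> n * norm (weighted_sum q x n) powr p)}"

definition Gamma_norm ::
  "real \<Rightarrow> (nat \<Rightarrow> real) \<Rightarrow> (nat \<Rightarrow> real) \<Rightarrow> (nat \<Rightarrow> 'a::real_normed_field) \<Rightarrow> real" where
  "Gamma_norm p \<gamma> q x = (\<Sum>n. \<gamma> n * norm (weighted_sum q x n) powr p) powr (1 / p)"

definition Gamma_dist ::
  "real \<Rightarrow> (nat \<Rightarrow> real) \<Rightarrow> (nat \<Rightarrow> real) \<Rightarrow>
     (nat \<Rightarrow> 'a::real_normed_field) \<Rightarrow> (nat \<Rightarrow> 'a) \<Rightarrow> real" where
  "Gamma_dist p \<gamma> q x y = Gamma_norm p \<gamma> q (\<lambda>n. x n - y n)"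

definition Gamma_topology ::
  "real \<Rightarrow> (nat \<Rightarrow> real) \<Rightarrow> (nat \<Rightarrow> real) \<Rightarrow> (nat \<Rightarrow> 'a::real_normed_field) topology" where
  "Gamma_topology p \<gamma> q = Metric_space.mtopology (Gamma_space p \<gamma> q) (Gamma_dist p \<gamma> q)"

definition Gamma_u ::
  "real \<Rightarrow> (nat \<Rightarrow> real) \<Rightarrow> (nat \<Rightarrow> real) \<Rightarrow> nat \<Rightarrow> nat \<Rightarrow> 'a::real_normed_field" where
  "Gamma_u p \<gamma> q n = (\<lambda>m. if m = n then of_real (\<gamma> n powr (- 1 / p) / q n)
                          else if m = Suc n then - of_real (\<gamma> n powr (- 1 / p) / q (Suc n))
                          else 0)"

text \<open>
  The next facts justify the definitions: for \<open>1 < p\<close> and positive \<open>\<gamma>\<close>, \<open>q\<close> the space is closed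
  under the linear operations, \<^const>\<open>Gamma_norm\<close> is a norm on it (so that
  \<^const>\<open>Gamma_topology\<close> is the topology of a metric space), and the \<open>u\<close> are members.
\<close>

lemma weighted_sum_add: "weighted_sum q (\<lambda>n. x n + y n) m = weighted_sum q x m + weighted_sum q y m"
  by (simp add: weighted_sum_def algebra_simps sum.distrib)

lemma weighted_sum_scale: "weighted_sum q (\<lambda>n. c * x n) m = c * weighted_sum q x m"
  by (simp add: weighted_sum_def sum_distrib_left algebra_simps)

lemma weighted_sum_eq_0_iff:
  assumes "\<And>n. q n > 0"
  shows "(\<forall>n. weighted_sum q x n = 0) \<longleftrightarrow> (\<forall>n. x n = 0)"
proof
  assume z: "\<forall>n. weighted_sum q x n = 0"
  show "\<forall>n. x n = 0"
  proof
    fix n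
    have "of_real (q n) * x n = 0"
    proof (cases n)
      case 0
      then show ?thesis using z[rule_format, of 0] by (simp add: weighted_sum_def)
    next
      case (Suc m)
      then show ?thesis using z[rule_format, of m] z[rule_format, of n]
        by (simp add: weighted_sum_def)
    qed
    then show "x n = 0" using assms[of n] by auto
  qed
qed (simp add: weighted_sum_def)

lemma Gamma_space_scale:
  assumes "x \<in> Gamma_space p \<gamma> q"
  shows "(\<lambda>n. c * x n) \<in> Gamma_space p \<gamma> q"
proof -
  have "summable (\<lambda>n. norm c powr p * (\<gamma> n * norm (weighted_sum q x n) powr p))"
    using assms by (intro summable_mult) (simp add: Gamma_space_def)
  then show ?thesis
    by (simp add: Gamma_space_def weighted_sum_scale norm_mult powr_mult algebra_simps)
qed

lemma Gamma_norm_scale: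
  assumes "p > 1" "\<And>n. \<gamma> n > 0" "x \<in> Gamma_space p \<gamma> q"
  shows "Gamma_norm p \<gamma> q (\<lambda>n. c * x n) = norm c * Gamma_norm p \<gamma> q x"
proof -
  let ?f = "\<lambda>n. \<gamma> n * norm (weighted_sum q x n) powr p"
  have s: "summable ?f" using assms by (simp add: Gamma_space_def)
  have "(\<Sum>n. \<gamma> n * norm (weighted_sum q (\<lambda>n. c * x n) n) powr p) = norm c powr p * suminf ?f"
    unfolding suminf_mult[OF s, symmetric]
    by (simp add: weighted_sum_scale norm_mult powr_mult algebra_simps)
  moreover have "suminf ?f \<ge> 0"
    using assms by (intro suminf_nonneg s) (simp add: less_imp_le)
  ultimately show ?thesis
    using assms by (simp add: Gamma_norm_def powr_mult powr_powr)
qed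

lemma Gamma_norm_nonneg: "0 \<le> Gamma_norm p \<gamma> q x"
  by (simp add: Gamma_norm_def)

lemma Gamma_norm_powr:
  assumes "p > 1" "\<And>n. \<gamma> n > 0" "x \<in> Gamma_space p \<gamma> q"
  shows "(\<Sum>n. \<gamma> n * norm (weighted_sum q x n) powr p) = Gamma_norm p \<gamma> q x powr p"
proof -
  have "(\<Sum>n. \<gamma> n * norm (weighted_sum q x n) powr p) \<ge> 0"
    using assms by (intro suminf_nonneg) (auto simp: Gamma_space_def less_imp_le)
  then show ?thesis using assms by (simp add: Gamma_norm_def powr_powr)
qed

lemma Gamma_norm_eq_0_iff:
  assumes "p > 1" "\<And>n. \<gamma> n > 0" "\<And>n. q n > 0" "x \<in> Gamma_space p \<gamma> q"
  shows "Gamma_norm p \<gamma> q x = 0 \<longleftrightarrow> x = (\<lambda>n. 0)"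
proof -
  have "Gamma_norm p \<gamma> q x = 0 \<longleftrightarrow> (\<Sum>n. \<gamma> n * norm (weighted_sum q x n) powr p) = 0"
    by (simp add: Gamma_norm_def)
  also have "\<dots> \<longleftrightarrow> (\<forall>n. \<gamma> n * norm (weighted_sum q x n) powr p = 0)"
    using assms by (intro suminf_eq_zero_iff) (auto simp: Gamma_space_def less_imp_le)
  also have "\<dots> \<longleftrightarrow> (\<forall>n. weighted_sum q x n = 0)"
    using assms(2) by (metis mult_eq_0_iff norm_eq_zero less_irrefl powr_eq_0_iff)
  also have "\<dots> \<longleftrightarrow> x = (\<lambda>n. 0)"
    using weighted_sum_eq_0_iff[where q = q and x = x, OF assms(3)] by auto
  finally show ?thesis .
qed

lemma powr_convex_nonneg:
  fixes p :: real
  assumes "p \<ge> 1"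
  shows "convex_on {0..} (\<lambda>x. x powr p)"
proof (rule convex_onI)
  fix t x y :: real
  assume t: "0 < t" "t < 1" and xy: "x \<in> {0..}" "y \<in> {0..}"
  have sub: "(r * z) powr p \<le> r * z powr p" if "0 < r" "r < 1" "z \<ge> 0" for r z :: real
  proof -
    have "r powr p \<le> r powr 1" using that assms by (intro powr_mono') auto
    then show ?thesis using that by (simp add: powr_mult mult_right_mono)
  qed
  consider "x = 0" | "y = 0" | "x > 0" "y > 0" using xy by force
  then show "((1 - t) *\<^sub>R x + t *\<^sub>R y) powr p \<le> (1 - t) * x powr p + t * y powr p"
  proof cases
    case 1
    then show ?thesis using sub[of t y] t xy by simp
  next
    case 2
    then show ?thesis using sub[of "1 - t" x] t xy by simp
  next
    case 3
    then show ?thesis using convex_onD[OF powr_convex[OF assms], of t x y] t by simp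
  qed
qed (simp add: convex_real_interval)

lemma powr_add_le_convex:
  fixes s t a b p :: real
  assumes "p > 1" "a > 0" "b > 0" "s \<ge> 0" "t \<ge> 0"
  shows "(s + t) powr p \<le> (a + b) powr p *
           (a / (a + b) * (s / a) powr p + b / (a + b) * (t / b) powr p)"
proof -
  have c: "convex_on {0..} (\<lambda>x::real. x powr p)"
    using assms by (intro powr_convex_nonneg) auto
  have "((1 - b / (a + b)) *\<^sub>R (s / a) + (b / (a + b)) *\<^sub>R (t / b)) powr p
      \<le> (1 - b / (a + b)) * (s / a) powr p + b / (a + b) * (t / b) powr p"
    using assms by (intro convex_onD[OF c]) auto
  moreover have "1 - b / (a + b) = a / (a + b)"
    using assms by (simp add: field_simps)
  moreover have "(a / (a + b)) *\<^sub>R (s / a) + (b / (a + b)) *\<^sub>R (t / b) = (s + t) / (a + b)"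
    using assms by (simp add: add_divide_distrib)
  ultimately have "((s + t) / (a + b)) powr p
      \<le> a / (a + b) * (s / a) powr p + b / (a + b) * (t / b) powr p"
    by simp
  then have "(a + b) powr p * ((s + t) / (a + b)) powr p
      \<le> (a + b) powr p * (a / (a + b) * (s / a) powr p + b / (a + b) * (t / b) powr p)"
    by (intro mult_left_mono) auto
  then show ?thesis using assms by (simp add: powr_divide)
qed

lemma Gamma_add_bound:
  assumes p: "p > 1" and g: "\<And>n. \<gamma> n > 0"
    and x: "x \<in> Gamma_space p \<gamma> q" and y: "y \<in> Gamma_space p \<gamma> q"
    and a: "a > 0" "Gamma_norm p \<gamma> q x \<le> a" and b: "b > 0" "Gamma_norm p \<gamma> q y \<le> b"
  shows "(\<lambda>n. x n + y n) \<in> Gamma_space p \<gamma> q \<and> Gamma_norm p \<gamma> q (\<lambda>n. x n + y n) \<le> a + b"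
proof -
  define X where "X = (\<lambda>n. \<gamma> n * norm (weighted_sum q x n) powr p)"
  define Y where "Y = (\<lambda>n. \<gamma> n * norm (weighted_sum q y n) powr p)"
  define Z where "Z = (\<lambda>n. \<gamma> n * norm (weighted_sum q (\<lambda>n. x n + y n) n) powr p)"
  define A where "A = (a + b) powr p * (a / (a + b)) / a powr p"
  define B where "B = (a + b) powr p * (b / (a + b)) / b powr p"
  have A0: "A \<ge> 0" and B0: "B \<ge> 0" using a b by (auto simp: A_def B_def)
  have sX: "summable X" and sY: "summable Y"
    using x y by (auto simp: X_def Y_def Gamma_space_def)
  have Xle: "suminf X \<le> a powr p"
    unfolding X_def Gamma_norm_powr[OF p g x] using a p
    by (intro powr_mono2) (auto simp: Gamma_norm_nonneg)
  have Yle: "suminf Y \<le> b powr p"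
    unfolding Y_def Gamma_norm_powr[OF p g y] using b p
    by (intro powr_mono2) (auto simp: Gamma_norm_nonneg)
  have Z0: "Z n \<ge> 0" for n using g[of n] by (simp add: Z_def)
  have ZXY: "Z n \<le> A * X n + B * Y n" for n
  proof -
    let ?s = "norm (weighted_sum q x n)" and ?t = "norm (weighted_sum q y n)"
    have "norm (weighted_sum q (\<lambda>n. x n + y n) n) powr p \<le> (?s + ?t) powr p"
      using p by (intro powr_mono2) (auto simp: weighted_sum_add norm_triangle_ineq)
    also have "\<dots> \<le> (a + b) powr p * (a / (a + b) * (?s / a) powr p + b / (a + b) * (?t / b) powr p)"
      using p a b by (intro powr_add_le_convex) auto
    also have "\<dots> = A * ?s powr p + B * ?t powr p"
      using a b by (simp add: A_def B_def powr_divide algebra_simps)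
    finally have "\<gamma> n * norm (weighted_sum q (\<lambda>n. x n + y n) n) powr p
        \<le> \<gamma> n * (A * ?s powr p + B * ?t powr p)"
      using g[of n] by (intro mult_left_mono) auto
    then show ?thesis by (simp add: X_def Y_def Z_def algebra_simps)
  qed
  have sXY: "summable (\<lambda>n. A * X n + B * Y n)"
    by (intro summable_add summable_mult sX sY)
  have sZ: "summable Z"
    by (rule summable_comparison_test'[OF sXY, of 0]) (use Z0 ZXY in auto)
  have "suminf Z \<le> (\<Sum>n. A * X n + B * Y n)"
    by (intro suminf_le ZXY sZ sXY)
  also have "\<dots> = A * suminf X + B * suminf Y"
    using sX sY by (simp add: suminf_add[symmetric] suminf_mult summable_mult)
  also have "\<dots> \<le> A * a powr p + B * b powr p"
    by (intro add_mono mult_left_mono Xle Yle A0 B0)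
  also have "\<dots> = (a + b) powr p * (a / (a + b) + b / (a + b))"
    using a b by (simp add: A_def B_def distrib_left)
  also have "a / (a + b) + b / (a + b) = 1"
    using a b by (simp add: add_divide_distrib[symmetric])
  finally have "suminf Z \<le> (a + b) powr p" by simp
  then have "suminf Z powr (1 / p) \<le> ((a + b) powr p) powr (1 / p)"
    using p by (intro powr_mono2 suminf_nonneg sZ Z0) auto
  also have "\<dots> = a + b" using p a b by (simp add: powr_powr)
  finally show ?thesis
    using sZ by (simp add: Gamma_norm_def Gamma_space_def Z_def)
qed

lemma Gamma_space_add:
  assumes "p > 1" "\<And>n. \<gamma> n > 0" "x \<in> Gamma_space p \<gamma> q" "y \<in> Gamma_space p \<gamma> q"
  shows "(\<lambda>n. x n + y n) \<in> Gamma_space p \<gamma> q"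
  using Gamma_add_bound[OF assms, of "Gamma_norm p \<gamma> q x + 1" "Gamma_norm p \<gamma> q y + 1"]
    Gamma_norm_nonneg[of p \<gamma> q x] Gamma_norm_nonneg[of p \<gamma> q y] by simp

lemma Gamma_norm_triangle:
  assumes "p > 1" "\<And>n. \<gamma> n > 0" "x \<in> Gamma_space p \<gamma> q" "y \<in> Gamma_space p \<gamma> q"
  shows "Gamma_norm p \<gamma> q (\<lambda>n. x n + y n) \<le> Gamma_norm p \<gamma> q x + Gamma_norm p \<gamma> q y"
proof (rule field_le_epsilon)
  fix e :: real
  assume e: "e > 0"
  show "Gamma_norm p \<gamma> q (\<lambda>n. x n + y n) \<le> Gamma_norm p \<gamma> q x + Gamma_norm p \<gamma> q y + e"
    using Gamma_add_bound[OF assms, of "Gamma_norm p \<gamma> q x + e / 2" "Gamma_norm p \<gamma> q y + e / 2"]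
      Gamma_norm_nonneg[of p \<gamma> q x] Gamma_norm_nonneg[of p \<gamma> q y] e by simp
qed

lemma Gamma_space_diff:
  assumes "p > 1" "\<And>n. \<gamma> n > 0" "x \<in> Gamma_space p \<gamma> q" "y \<in> Gamma_space p \<gamma> q"
  shows "(\<lambda>n. x n - y n) \<in> Gamma_space p \<gamma> q"
  using Gamma_space_add[OF assms(1,2,3) Gamma_space_scale[OF assms(4), of "- 1"]] by simp

lemma Metric_space_Gamma:
  assumes p: "p > 1" and g: "\<And>n. \<gamma> n > 0" and q: "\<And>n. q n > 0"
  shows "Metric_space (Gamma_space p \<gamma> q :: (nat \<Rightarrow> 'a::real_normed_field) set) (Gamma_dist p \<gamma> q)"
proof
  fix x y z :: "nat \<Rightarrow> 'a"
  show "0 \<le> Gamma_dist p \<gamma> q x y"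
    by (simp add: Gamma_dist_def Gamma_norm_nonneg)
  have "norm (weighted_sum q (\<lambda>n. x n - y n) m) = norm (weighted_sum q (\<lambda>n. y n - x n) m)" for m
    using weighted_sum_scale[of q "- 1" "\<lambda>n. x n - y n" m] by simp
  then show "Gamma_dist p \<gamma> q x y = Gamma_dist p \<gamma> q y x"
    by (simp add: Gamma_dist_def Gamma_norm_def)
  assume x: "x \<in> Gamma_space p \<gamma> q" and y: "y \<in> Gamma_space p \<gamma> q"
  show "Gamma_dist p \<gamma> q x y = 0 \<longleftrightarrow> x = y"
    using Gamma_norm_eq_0_iff[OF p g q Gamma_space_diff[OF p g x y]]
    by (auto simp: Gamma_dist_def fun_eq_iff)
  assume z: "z \<in> Gamma_space p \<gamma> q"
  show "Gamma_dist p \<gamma> q x z \<le> Gamma_dist p \<gamma> q x y + Gamma_dist p \<gamma> q y z"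
    using Gamma_norm_triangle[OF p g Gamma_space_diff[OF p g x y] Gamma_space_diff[OF p g y z]]
    by (simp add: Gamma_dist_def)
qed

lemma weighted_sum_Gamma_u:
  assumes "\<And>n. q n > 0"
  shows "weighted_sum q (Gamma_u p \<gamma> q n) m = (if m = n then of_real (\<gamma> n powr (- 1 / p)) else 0)"
proof -
  have q: "q k \<noteq> 0" for k using assms[of k] by simp
  have "of_real (q k) * Gamma_u p \<gamma> q n k
      = ((if n = k then of_real (\<gamma> n powr (- 1 / p)) else 0)
         - (if Suc n = k then of_real (\<gamma> n powr (- 1 / p)) else 0) :: 'a)" for k
    using q by (auto simp: Gamma_u_def)
  then show ?thesis
    by (simp add: weighted_sum_def sum_subtractf)
qed

lemma Gamma_u_in_Gamma_space:
  assumes "\<And>n. q n > 0"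
  shows "Gamma_u p \<gamma> q n \<in> Gamma_space p \<gamma> q"
  unfolding Gamma_space_def mem_Collect_eq
  by (rule summable_finite[of "{n}"])
    (auto simp: weighted_sum_Gamma_u[OF assms])

end

theory Submission
  imports Defs
begin

text \<open>
  The map sending \<open>x\<close> to the sequence $(\gamma_n^{1/p} \sum_{k \le n} q_k x_k)_n$ is a linear
  isometry of \<open>\<Gamma>\<^sub>p\<close> into $\ell^p$ that takes \<open>u\<^sub>n\<close> to the \<open>n\<close>-th unit vector. Hence the error
  of the \<open>N\<close>-th partial sum is the tail from \<open>N\<close> on of a convergent series. Since the \<open>u\<^sub>n\<close> have
  norm 1, the coefficients of a partial sum may then be perturbed into a countable dense set of
  scalars.
\<close>

text \<open>In \<open>Gamma_u p \<gamma> q i\<close> the entry at \<open>Suc i\<close> cancels the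
  contribution of the entry at \<open>i\<close>, so its weighted sums vanish except at index
  \<open>i\<close>. By linearity, the \<open>n\<close>-th weighted sum of a combination therefore
  sees the coefficient \<open>c n\<close> alone.\<close>

lemma weighted_sum_combination:
  fixes c :: "nat \<Rightarrow> 'a::real_normed_field"
  assumes "\<And>n. q n > 0"
  shows "weighted_sum q (\<lambda>m. \<Sum>i<N. c i * Gamma_u p \<gamma> q i m) n =
           (if n < N then c n * of_real (\<gamma> n powr (- 1 / p)) else 0)"
proof (induction N)
  case 0
  show ?case by (simp add: weighted_sum_def)
next
  case (Suc N)
  show ?case
    unfolding sum.lessThan_Suc weighted_sum_add Suc.IH weighted_sum_scale
      weighted_sum_Gamma_u[OF assms]
    by (auto simp: less_Suc_eq)
qed

lemma combination_in_Gamma_space: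
  fixes c :: "nat \<Rightarrow> 'a::real_normed_field"
  assumes "\<And>n. q n > 0"
  shows "(\<lambda>m. \<Sum>i<N. c i * Gamma_u p \<gamma> q i m) \<in> Gamma_space p \<gamma> q"
  unfolding Gamma_space_def mem_Collect_eq
  by (rule summable_finite[of "{..<N}"]) (auto simp: weighted_sum_combination[OF assms])

lemma Gamma_norm_u:
  assumes "p > 1" "\<And>n. \<gamma> n > 0" "\<And>n. q n > 0"
  shows "Gamma_norm p \<gamma> q (Gamma_u p \<gamma> q n :: nat \<Rightarrow> 'a::real_normed_field) = 1"
proof -
  \<comment> \<open>This is what the factor \<open>\<gamma> n powr (- 1 / p)\<close> in
    \<open>Gamma_u\<close> is for: its \<open>p\<close>-th power is the inverse of the
    weight.\<close>
  have "\<gamma> n * (\<gamma> n powr (- 1 / p)) powr p = 1"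
    using assms(1) assms(2)[of n] by (simp only: powr_powr) (simp add: powr_minus)
  then have "\<gamma> m * norm (weighted_sum q (Gamma_u p \<gamma> q n :: nat \<Rightarrow> 'a) m) powr p =
      (if m = n then 1 else 0)" for m
    by (auto simp: weighted_sum_Gamma_u[OF assms(3)])
  then show ?thesis
    using suminf_finite[of "{n}" "\<lambda>m. if m = n then 1 else 0 :: real"]
    by (simp add: Gamma_norm_def)
qed

text \<open>Triangle inequality over unit vectors. This crude bound suffices for perturbing
  coefficients, because there \<open>N\<close> is fixed before the size of the perturbation is
  chosen.\<close>

lemma Gamma_norm_combination_le:
  fixes c :: "nat \<Rightarrow> 'a::real_normed_field"
  assumes "p > 1" "\<And>n. \<gamma> n > 0" "\<And>n. q n > 0"
  shows "Gamma_norm p \<gamma> q (\<lambda>m. \<Sum>i<N. c i * Gamma_u p \<gamma> q i m) \<le> (\<Sum>i<N. norm (c i))"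
proof (induction N)
  case 0
  show ?case by (simp add: Gamma_norm_def weighted_sum_def)
next
  case (Suc N)
  have u: "(Gamma_u p \<gamma> q N :: nat \<Rightarrow> 'a) \<in> Gamma_space p \<gamma> q"
    by (rule Gamma_u_in_Gamma_space[OF assms(3)])
  show ?case
    using Gamma_norm_triangle[OF assms(1,2) combination_in_Gamma_space[where q = q and c = c and N = N, OF assms(3)]
        Gamma_space_scale[OF u, of "c N"]] Suc.IH
    by (simp add: Gamma_norm_scale[OF assms(1,2) u] Gamma_norm_u[OF assms])
qed

text \<open>Stated with real distances rather than \<open>limitin\<close>, so that it yields both
  the expansion and the truncation index in the separability proof.\<close>

lemma Gamma_expansion_tendsto:
  fixes x :: "nat \<Rightarrow> 'a::real_normed_field"
  assumes p: "p > 1" and g: "\<And>n. \<gamma> n > 0" and q: "\<And>n. q n > 0" and x: "x \<in> Gamma_space p \<gamma> q"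
  shows "(\<lambda>N. Gamma_dist p \<gamma> q
            (\<lambda>m. \<Sum>i<N. of_real (\<gamma> i powr (1 / p)) * weighted_sum q x i * Gamma_u p \<gamma> q i m) x)
          \<longlonglongrightarrow> 0"
proof -
  define f where "f n = \<gamma> n * norm (weighted_sum q x n) powr p" for n
  have f: "summable f" using x by (simp add: Gamma_space_def f_def[abs_def])
  let ?S = "\<lambda>N m. \<Sum>i<N. of_real (\<gamma> i powr (1 / p)) * weighted_sum q x i * Gamma_u p \<gamma> q i m"
  \<comment> \<open>The powers of \<gamma> cancel, so the partial sum reproduces the weighted sums
    of \<open>x\<close> below \<open>N\<close> and has none from \<open>N\<close> on.\<close>
  have S: "weighted_sum q (?S N) n = (if n < N then weighted_sum q x n else 0)" for N n
  proof -
    have "\<gamma> n powr (1 / p) * \<gamma> n powr (- 1 / p) = 1"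
      using g[of n] by (simp add: powr_add[symmetric])
    then have "of_real (\<gamma> n powr (1 / p)) * weighted_sum q x n * of_real (\<gamma> n powr (- 1 / p)) =
        weighted_sum q x n"
      by (metis mult.assoc mult.commute mult_1 of_real_1 of_real_mult)
    then show ?thesis
      unfolding weighted_sum_combination[OF q] by simp
  qed
  have D: "weighted_sum q (\<lambda>m. ?S N m - x m) n = (if n < N then 0 else - weighted_sum q x n)" for N n
    using weighted_sum_add[of q "?S N" "\<lambda>m. - 1 * x m" n]
    unfolding S weighted_sum_scale by simp
  have tail: "(\<Sum>n. \<gamma> n * norm (weighted_sum q (\<lambda>m. ?S N m - x m) n) powr p) = (\<Sum>n. f (n + N))"
    for N
  proof -
    let ?h = "\<lambda>n. if n < N then 0 else f n"
    have "summable ?h"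
      by (rule summable_comparison_test'[OF f, of 0]) (auto simp: f_def less_imp_le[OF g])
    then have "suminf ?h = (\<Sum>n. ?h (n + N)) + (\<Sum>n<N. ?h n)"
      by (rule suminf_split_initial_segment)
    moreover have "\<gamma> n * norm (weighted_sum q (\<lambda>m. ?S N m - x m) n) powr p = ?h n" for n
      unfolding D by (simp add: f_def)
    ultimately show ?thesis by simp
  qed
  \<comment> \<open>The base tends to 0, so passing to the limit under \<open>powr\<close> relies on
    nonnegative tails and on \<open>1 / p > 0\<close>.\<close>
  have "(\<lambda>N. (\<Sum>n. f (n + N)) powr (1 / p)) \<longlonglongrightarrow> 0 powr (1 / p)"
  proof (rule tendsto_powr2)
    show "(\<lambda>N. \<Sum>n. f (n + N)) \<longlonglongrightarrow> 0"
      by (rule suminf_exist_split2[OF f])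
    show "\<forall>\<^sub>F N in sequentially. 0 \<le> (\<Sum>n. f (n + N))"
      by (intro always_eventually allI suminf_nonneg summable_ignore_initial_segment f)
        (simp add: f_def less_imp_le[OF g])
  qed (use p in auto)
  then show ?thesis
    unfolding Gamma_dist_def Gamma_norm_def tail by simp
qed

lemma limitin_Gamma_expansion:
  fixes x :: "nat \<Rightarrow> 'a::real_normed_field"
  assumes p: "p > 1" and g: "\<And>n. \<gamma> n > 0" and q: "\<And>n. q n > 0" and x: "x \<in> Gamma_space p \<gamma> q"
  shows "limitin (Gamma_topology p \<gamma> q)
           (\<lambda>N. \<lambda>m. \<Sum>i<N. of_real (\<gamma> i powr (1 / p)) * weighted_sum q x i * Gamma_u p \<gamma> q i m)
           x sequentially"
proof -
  interpret Metric_space "Gamma_space p \<gamma> q :: (nat \<Rightarrow> 'a) set" "Gamma_dist p \<gamma> q"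
    by (rule Metric_space_Gamma[OF p g q])
  show ?thesis
    unfolding Gamma_topology_def limitin_metric_dist_null
    using x Gamma_expansion_tendsto[OF p g q x]
    by (intro conjI always_eventually allI combination_in_Gamma_space[OF q])
qed

lemma separable_Gamma_topology:
  assumes p: "p > 1" and g: "\<And>n. \<gamma> n > 0" and q: "\<And>n. q n > 0"
  shows "separable_space
    (Gamma_topology p \<gamma> q :: (nat \<Rightarrow> 'a::{real_normed_field, second_countable_topology}) topology)"
proof -
  interpret Metric_space "Gamma_space p \<gamma> q :: (nat \<Rightarrow> 'a) set" "Gamma_dist p \<gamma> q"
    by (rule Metric_space_Gamma[OF p g q])
  define comb where "comb N c = (\<lambda>m. \<Sum>i<N. c i * Gamma_u p \<gamma> q i m)"
    for N and c :: "nat \<Rightarrow> 'a"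
  have comb: "comb N c \<in> Gamma_space p \<gamma> q" for N c
    unfolding comb_def by (rule combination_in_Gamma_space[OF q])
  obtain D :: "'a set" where D: "countable D"
      and dense: "\<And>U. open U \<Longrightarrow> U \<noteq> {} \<Longrightarrow> \<exists>d\<in>D. d \<in> U"
    by (metis countable_dense_exists)
  \<comment> \<open>Finite lists over \<open>D\<close> index the coefficients, which keeps
    \<open>C\<close> countable; all sequences in \<open>D\<close> could be uncountably many.\<close>
  define C where "C = (\<lambda>cs. comb (length cs) ((!) cs)) ` lists D"
  have "\<exists>y\<in>C. y \<in> mball x e" if x: "x \<in> Gamma_space p \<gamma> q" and e: "e > 0" for x e
  proof -
    define c where "c i = of_real (\<gamma> i powr (1 / p)) * weighted_sum q x i" for i
    have "\<forall>\<^sub>F N in sequentially. Gamma_dist p \<gamma> q (comb N c) x < e / 2"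
      using order_tendstoD(2)[OF Gamma_expansion_tendsto[OF p g q x], of "e / 2"] e
      by (simp add: comb_def c_def)
    then obtain N where N: "Gamma_dist p \<gamma> q (comb N c) x < e / 2"
      by (meson eventually_happens sequentially_bot)
    \<comment> \<open>\<open>N\<close> coefficient errors below \<delta> add up to at most
      \<open>e / 2\<close>; the \<open>+ 1\<close> keeps the denominator positive when
      \<open>N = 0\<close>.\<close>
    define \<delta> where "\<delta> = e / (2 * (real N + 1))"
    have \<delta>: "\<delta> > 0" using e by (simp add: \<delta>_def)
    have "\<exists>b\<in>D. norm (b - c i) < \<delta>" for i
      using dense[of "ball (c i) \<delta>"] \<delta> by (auto simp: dist_norm norm_minus_commute)
    then obtain b where b: "\<And>i. b i \<in> D" "\<And>i. norm (b i - c i) < \<delta>"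
      by metis
    have "comb N b \<in> C"
      \<comment> \<open>Only the values of \<open>b\<close> below \<open>N\<close> enter
        \<open>comb N b\<close>, so the list of these values represents it.\<close>
      unfolding C_def
      by (rule image_eqI[of _ _ "map b [0..<N]"]) (auto simp: comb_def b)
    moreover have "Gamma_dist p \<gamma> q (comb N b) (comb N c) \<le> e / 2"
    proof -
      have "Gamma_dist p \<gamma> q (comb N b) (comb N c) = Gamma_norm p \<gamma> q (comb N (\<lambda>i. b i - c i))"
        by (simp add: Gamma_dist_def comb_def sum_subtractf left_diff_distrib)
      also have "\<dots> \<le> (\<Sum>i<N. norm (b i - c i))"
        unfolding comb_def by (rule Gamma_norm_combination_le[OF p g q])
      also have "\<dots> \<le> (\<Sum>i<N. \<delta>)"
        by (intro sum_mono less_imp_le b)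
      also have "\<dots> \<le> e / 2"
        using e by (simp add: \<delta>_def field_simps)
      finally show ?thesis .
    qed
    \<comment> \<open>One half of \<open>e\<close> pays for rounding the coefficients, the other for
      truncation, where the inequality is strict.\<close>
    then have "Gamma_dist p \<gamma> q x (comb N b) < e"
      using triangle[OF comb comb x, of N b N c] N by (simp add: commute)
    ultimately show ?thesis
      using x comb by auto
  qed
  then have "mtopology closure_of C = Gamma_space p \<gamma> q"
    unfolding metric_closure_of by blast
  moreover have "countable C"
    unfolding C_def using D by simp
  moreover have "C \<subseteq> Gamma_space p \<gamma> q"
    using comb by (auto simp: C_def)
  ultimately show ?thesis
    unfolding separable_space_def Gamma_topology_def topspace_mtopology by blast
qed

theorem theorem4p2:
  fixes p :: real and \<gamma> q :: "nat \<Rightarrow> real"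
  assumes "1 < p"
    and "\<And>n. \<gamma> n > 0"
    and "\<And>n. q n > 0"
  shows "(\<forall>x \<in> (Gamma_space p \<gamma> q :: (nat \<Rightarrow> real) set).
            limitin (Gamma_topology p \<gamma> q)
              (\<lambda>N. \<lambda>m. \<Sum>i<N. (of_real (\<gamma> i powr (1 / p)) * (\<Sum>k\<le>i. of_real (q k) * x k)) * Gamma_u p \<gamma> q i m)
              x sequentially)
       \<and> separable_space (Gamma_topology p \<gamma> q :: (nat \<Rightarrow> real) topology)
       \<and> (\<forall>x \<in> (Gamma_space p \<gamma> q :: (nat \<Rightarrow> complex) set).
            limitin (Gamma_topology p \<gamma> q)
              (\<lambda>N. \<lambda>m. \<Sum>i<N. (of_real (\<gamma> i powr (1 / p)) * (\<Sum>k\<le>i. of_real (q k) * x k)) * Gamma_u p \<gamma> q i m)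
              x sequentially)
       \<and> separable_space (Gamma_topology p \<gamma> q :: (nat \<Rightarrow> complex) topology)"
  \<comment> \<open>The general lemmas are instantiated at \<open>real\<close> and
    \<open>complex\<close>; unfolding \<open>weighted_sum\<close> gives the explicit inner sum of
    the statement.\<close>
  by (intro conjI ballI limitin_Gamma_expansion[unfolded weighted_sum_def]
      separable_Gamma_topology assms)

end
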